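(* For every $\tau\in\mathbb{R}_{\ge0}^{|E|T}$ and $\alpha\in[0,1]^{|E|T}$, the set of $(\tau,\alpha)$-DBCP equilibrium flows is non-empty.
   Context: Network. $(I,E)$ is a finite acyclic directed graph; $E_i^{\mathrm{in}},E_i^{\mathrm{out}}$ are the edges entering/leaving node $i$. Each edge has two lanes $k\in[2]=\{1,2\}$: an express lane ($k=1$, may be tolled) and a toll-free general-purpose lane ($k=2$). Both lanes of $e$ have the same latency function $\ell_e:\mathbb{R}\to\mathbb{R}$, strictly increasing, convex, nonnegative on $\mathbb{R}_{\ge0}$. Periods are $t\in[T]=\{1,\dots,T\}$. Users. $G=G^E\sqcup G^I$ is a finite set of groups, eligible ($G^E$) or ineligible ($G^I$). Group $g$ has an origin $p_o^g$ and destination $p_d^g$ joined by at least one directed route, a demand $d^g\ge0$, and values of time $v_t^g>0$, $t\in[T]$. $G_e$ is the set of groups having a route from $p_o^g$ to $p_d^g$ containing $e$; $n=\sum_{e}|G_e|$. Flows. A flow is $y=(y_{e,k,t}^g: e\in E,k\in[2],t\in[T],g\in G_e)\in\mathbb{R}_{\ge0}^{2nT}$; $\mathcal{Y}_{\mathrm{adm}}$ is the set of flows such that for all $i\in I,g\in G,t\in[T]$: $d^g\mathbf 1\{i=p_o^g\}+\sum_{e\in E_i^{\mathrm{in}}}\sum_{k}y_{e,k,t}^g=d^g\mathbf 1\{i=p_d^g\}+\sum_{e\in E_i^{\mathrm{out}}}\sum_{k}y_{e,k,t}^g$ (sums over edges with $g\in G_e$). Lane flows: $x_{e,k,t}=\sum_{g\in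 G_e}y_{e,k,t}^g$. DBCP (discount-based congestion pricing). A policy is $(\tau,\alpha)$ with tolls $\tau\in\mathbb{R}_{\ge0}^{|E|T}$ and discounts $\alpha\in[0,1]^{|E|T}$. The feasible set is $\mathcal{Y}_{\mathrm{adm}}$. The cost $c_{e,k,t}^g(y)$ is $v_t^g\ell_e(x_{e,1,t})+\tau_{e,t}$ if $k=1,g\in G^I$; $v_t^g\ell_e(x_{e,1,t})+(1-\alpha_{e,t})\tau_{e,t}$ if $k=1,g\in G^E$; $v_t^g\ell_e(x_{e,2,t})$ if $k=2$. A flow $y^\star\in\mathcal{Y}_{\mathrm{adm}}$ is a $(\tau,\alpha)$-DBCP equilibrium if for each $g\in G$ and every $y\in\mathcal{Y}_{\mathrm{adm}}$: $\sum_{e,k,t}(y_{e,k,t}^g-y_{e,k,t}^{g\star})c_{e,k,t}^g(y^\star)\ge0$. *)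

theory Defs
  imports "HOL-Analysis.Analysis" "Graph_Theory.Graph_Theory"
begin

(* Arcs are abstract, so parallel edges between two nodes are permitted. *)
locale dbcp_network = fin_digraph N for N :: "('i, 'e) pre_digraph" (structure) +
  fixes T :: nat
    and latency :: "'e \<Rightarrow> real \<Rightarrow> real"
    and GE GI :: "'g set"
    and orig dest :: "'g \<Rightarrow> 'i"
    and demand :: "'g \<Rightarrow> real"
    and vot :: "'g \<Rightarrow> nat \<Rightarrow> real"
  assumes acyclic: "\<nexists>p. cycle p"
    and latency_strict_mono: "e \<in> arcs N \<Longrightarrow> strict_mono_on {0..} (latency e)"
    and latency_convex: "e \<in> arcs N \<Longrightarrow> convex_on {0..} (latency e)"
    and latency_nonneg: "e \<in> arcs N \<Longrightarrow> x \<ge> 0 \<Longrightarrow> latency e x \<ge> 0"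
    and finite_eligible: "finite GE"
    and finite_ineligible: "finite GI"
    and eligible_disjoint: "GE \<inter> GI = {}"
    and route_exists: "g \<in> GE \<union> GI \<Longrightarrow> \<exists>p. awalk (orig g) p (dest g)"
    and demand_nonneg: "g \<in> GE \<union> GI \<Longrightarrow> demand g \<ge> 0"
    and vot_pos: "g \<in> GE \<union> GI \<Longrightarrow> t \<in> {1..T} \<Longrightarrow> vot g t > 0"
begin

definition groups :: "'g set" where
  "groups = GE \<union> GI"

(* The set G_e.  In an acyclic digraph every directed walk is a path. *)
definition groups_on :: "'e \<Rightarrow> 'g set" where
  "groups_on e = {g \<in> groups. \<exists>p. awalk (orig g) p (dest g) \<and> e \<in> set p}"

(* The arcs e with g in G_e. *)
definition arcs_of :: "'g \<Rightarrow> 'e set" where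
  "arcs_of g = {e \<in> arcs N. g \<in> groups_on e}"

(* Lane 1 is the express lane, lane 2 the general-purpose lane. *)
definition flow_index :: "('e \<times> nat \<times> nat \<times> 'g) set" where
  "flow_index = {(e, k, t, g). e \<in> arcs N \<and> k \<in> {1, 2} \<and> t \<in> {1..T} \<and> g \<in> groups_on e}"

definition flows :: "('e \<times> nat \<times> nat \<times> 'g \<Rightarrow> real) set" where
  "flows = flow_index \<rightarrow>\<^sub>E {0..}"

definition admissible_flows :: "('e \<times> nat \<times> nat \<times> 'g \<Rightarrow> real) set" where
  "admissible_flows = {y \<in> flows. \<forall>i \<in> verts N. \<forall>g \<in> groups. \<forall>t \<in> {1..T}.
     demand g * of_bool (i = orig g)
       + (\<Sum>e \<in> in_arcs N i \<inter> arcs_of g. \<Sum>k \<in> {1, 2}. y (e, k, t, g))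
     = demand g * of_bool (i = dest g)
       + (\<Sum>e \<in> out_arcs N i \<inter> arcs_of g. \<Sum>k \<in> {1, 2}. y (e, k, t, g))}"

definition lane_flow :: "('e \<times> nat \<times> nat \<times> 'g \<Rightarrow> real) \<Rightarrow> 'e \<Rightarrow> nat \<Rightarrow> nat \<Rightarrow> real" where
  "lane_flow y e k t = (\<Sum>g \<in> groups_on e. y (e, k, t, g))"

definition cost :: "('e \<times> nat \<Rightarrow> real) \<Rightarrow> ('e \<times> nat \<Rightarrow> real) \<Rightarrow> 
    ('e \<times> nat \<times> nat \<times> 'g \<Rightarrow> real) \<Rightarrow> 'e \<Rightarrow> nat \<Rightarrow> nat \<Rightarrow> 'g \<Rightarrow> real" where
  "cost \<tau> \<alpha> y e k t g =
     (if k = 1 then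
        (if g \<in> GE then vot g t * latency e (lane_flow y e 1 t) + (1 - \<alpha> (e, t)) * \<tau> (e, t)
         else vot g t * latency e (lane_flow y e 1 t) + \<tau> (e, t))
      else vot g t * latency e (lane_flow y e 2 t))"

definition dbcp_equilibria :: "('e \<times> nat \<Rightarrow> real) \<Rightarrow> ('e \<times> nat \<Rightarrow> real) \<Rightarrow>
    ('e \<times> nat \<times> nat \<times> 'g \<Rightarrow> real) set" where
  "dbcp_equilibria \<tau> \<alpha> = {y' \<in> admissible_flows. \<forall>g \<in> groups. \<forall>y \<in> admissible_flows.
     (\<Sum>e \<in> arcs_of g. \<Sum>k \<in> {1, 2}. \<Sum>t \<in> {1..T}.
        (y (e, k, t, g) - y' (e, k, t, g)) * cost \<tau> \<alpha> y' e k t g) \<ge> 0}"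

end

end

(* Writing each toll in units of time, i.e. dividing it by the value of time of the paying group,
   turns the game into a potential game of Beckmann type: the potential sums the primitives of the
   latencies at the lane flows and a linear toll term. It is coercive, so it has a minimiser on the
   closed set of admissible flows. Moving from a minimiser towards a flow that differs from it in
   one group and one period only gives a variational inequality for that group and period;
   multiplying by the value of time and summing over periods yields the equilibrium condition. *)
theory Submission
  imports Defs
begin

section \<open>One-variable calculus, compact boxes and flow balance along walks\<close>

text \<open>Convexity settles the open half-line. At the endpoint 0 a convex function could still
  drop below \<open>f 0\<close> immediately; monotonicity forbids this, and the chord from 0 to 1
  bounds \<open>f\<close> from above, so \<open>f\<close> is squeezed towards
  \<open>f 0\<close>.\<close>

lemma convex_mono_continuous_on:
  fixes f :: "real \<Rightarrow> real"
  assumes mono: "mono_on {0..} f" and conv: "convex_on {0..} f"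
  shows "continuous_on {0..} f"
proof -
  have "continuous_on {0<..} f"
    by (rule convex_on_continuous) (auto intro: convex_on_subset[OF conv])
  then have pos: "continuous (at x within {0..}) f" if "x > 0" for x
    using that by (simp add: continuous_on_eq_continuous_at continuous_at_imp_continuous_at_within)
  have "(f \<longlongrightarrow> f 0) (at 0 within {0..})"
  proof (rule tendsto_sandwich)
    show "\<forall>\<^sub>F x in at 0 within {0..}. f 0 \<le> f x"
      using monotone_onD[OF mono] by (auto simp: eventually_at_filter)
    have "f x \<le> (1 - x) * f 0 + x * f 1" if "0 \<le> x" "x \<le> 1" for x
      using convex_onD[OF conv, of x 0 1] that by simp
    then show "\<forall>\<^sub>F x in at 0 within {0..}. f x \<le> (1 - x) * f 0 + x * f 1"
      unfolding eventually_at by (intro exI[of _ 1]) (auto simp: dist_real_def)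
    show "((\<lambda>x. (1 - x) * f 0 + x * f 1) \<longlongrightarrow> f 0) (at 0 within {0..})"
      by (auto intro!: tendsto_eq_intros)
  qed auto
  with pos show ?thesis
    by (metis atLeast_iff continuous_on_eq_continuous_within continuous_within less_eq_real_def)
qed

text \<open>Tangent inequality for the primitive of \<open>f\<close>, which is convex because
  \<open>f\<close> increases. On the interval between \<open>a\<close> and \<open>b\<close>,
  \<open>f\<close> is compared with the constant \<open>f a\<close>; for \<open>b < a\<close> both
  the comparison and the sign of the integral turn over.\<close>

lemma integral_mono_tangent:
  fixes f :: "real \<Rightarrow> real"
  assumes cont: "continuous_on {0..} f" and mono: "mono_on {0..} f"
    and "0 \<le> a" "0 \<le> b"
  shows "f a * (b - a) \<le> integral {0..b} f - integral {0..a} f"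
proof -
  have int: "f integrable_on {c..d}" if "0 \<le> c" for c d
    using that by (intro integrable_continuous_interval continuous_on_subset[OF cont]) auto
  show ?thesis
  proof (cases "a \<le> b")
    case True
    have "integral {0..a} f + integral {a..b} f = integral {0..b} f"
      using True assms int by (intro Henstock_Kurzweil_Integration.integral_combine) auto
    moreover have "integral {a..b} (\<lambda>_. f a) \<le> integral {a..b} f"
      using assms int by (intro integral_le) (auto intro: monotone_onD[OF mono])
    ultimately show ?thesis
      using True by (simp add: mult.commute)
  next
    case False
    have "integral {0..b} f + integral {b..a} f = integral {0..a} f"
      using False assms int by (intro Henstock_Kurzweil_Integration.integral_combine) auto
    moreover have "integral {b..a} f \<le> integral {b..a} (\<lambda>_. f a)"
      using assms int by (intro integral_le) (auto intro: monotone_onD[OF mono])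
    ultimately show ?thesis
      using False by (simp add: algebra_simps)
  qed
qed

text \<open>Tychonoff's theorem, carried over from the product topology to the topology of the
  function type.\<close>

lemma compact_box_fun:
  fixes S :: "'a \<Rightarrow> real set"
  assumes "\<And>i. compact (S i)"
  shows "compact {f. \<forall>i. f i \<in> S i}"
proof -
  have "compactin (product_topology (\<lambda>_. euclidean) UNIV) (PiE UNIV S)"
    using assms by (simp add: compactin_PiE)
  then show ?thesis
    by (simp add: euclidean_product_topology PiE_UNIV_domain Pi_def)
qed

lemma sum_count_list_Cons:
  assumes "finite A"
  shows "(\<Sum>x \<in> A. count_list (e # p) x) = of_bool (e \<in> A) + (\<Sum>x \<in> A. count_list p x)"
proof -
  have "(\<Sum>x \<in> A. count_list (e # p) x) = (\<Sum>x \<in> A. (if x = e then 1 else 0) + count_list p x)"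
    by (intro sum.cong) auto
  then show ?thesis
    using assms by (simp add: sum.distrib)
qed

text \<open>Flow conservation for one unit sent along a walk: prepending an arc moves the source
  indicator from the tail of that arc to its head. Arcs are counted with multiplicity, and both
  sides are sums, so natural numbers suffice.\<close>

lemma (in fin_digraph) awalk_flow_balance:
  assumes "awalk u p v"
  shows "of_bool (i = u) + (\<Sum>e \<in> in_arcs G i. count_list p e)
    = of_bool (i = v) + (\<Sum>e \<in> out_arcs G i. count_list p e)"
  using assms
proof (induction p arbitrary: u)
  case Nil
  then show ?case by (simp add: awalk_Nil_iff)
next
  case (Cons a p)
  then have "a \<in> arcs G" "u = tail G a" "awalk (head G a) p v"
    by (auto simp: awalk_Cons_iff)
  moreover have "finite (in_arcs G i)" "finite (out_arcs G i)"
    by (simp_all add: in_arcs_def out_arcs_def)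
  ultimately show ?case
    using Cons.IH[of "head G a"]
    by (auto simp: sum_count_list_Cons simp del: count_list.simps)
qed

section \<open>Admissible flows: existence, convex combinations, exchange of blocks\<close>

context dbcp_network
begin

lemma finite_groups: "finite groups"
  by (simp add: groups_def finite_eligible finite_ineligible)

lemma finite_groups_on [simp]: "finite (groups_on e)"
  using finite_groups by (simp add: groups_on_def)

lemma flow_nonneg: "y \<in> admissible_flows \<Longrightarrow> i \<in> flow_index \<Longrightarrow> 0 \<le> y i"
  by (auto simp: admissible_flows_def flows_def dest!: PiE_mem)

lemma lane_flow_nonneg:
  assumes "y \<in> admissible_flows" "e \<in> arcs N" "k \<in> {1, 2}" "t \<in> {1..T}"
  shows "0 \<le> lane_flow y e k t"
  using assms unfolding lane_flow_def
  by (intro sum_nonneg flow_nonneg[OF assms(1)]) (auto simp: flow_index_def)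

lemma latency_mono: "e \<in> arcs N \<Longrightarrow> mono_on {0..} (latency e)"
  by (simp add: latency_strict_mono strict_mono_on_imp_mono_on)

lemma latency_continuous: "e \<in> arcs N \<Longrightarrow> continuous_on {0..} (latency e)"
  by (simp add: convex_mono_continuous_on latency_mono latency_convex)

text \<open>In every period each group sends its whole demand along one fixed route on lane 1;
  conservation is the walk balance scaled by the demand.\<close>

lemma admissible_nonempty: "admissible_flows \<noteq> {}"
proof -
  obtain p where p: "awalk (orig g) (p g) (dest g)" if "g \<in> groups" for g
    using route_exists unfolding groups_def by metis
  define y where "y = restrict (\<lambda>(e, k, t, g).
    if k = 1 then demand g * count_list (p g) e else 0) flow_index"
  have "y \<in> flows"
    using demand_nonneg
    by (auto simp: y_def flows_def flow_index_def groups_on_def groups_def split: if_splits)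
  moreover have eq: "(\<Sum>e \<in> A \<inter> arcs_of g. \<Sum>k \<in> {1, 2}. y (e, k, t, g))
      = demand g * real (\<Sum>e \<in> A. count_list (p g) e)"
    if "A \<subseteq> arcs N" "g \<in> groups" "t \<in> {1..T}" for A g t
  proof -
    have "finite A"
      using that(1) finite_arcs finite_subset by blast
    have "(\<Sum>e \<in> A \<inter> arcs_of g. \<Sum>k \<in> {1, 2}. y (e, k, t, g))
        = (\<Sum>e \<in> A \<inter> arcs_of g. demand g * real (count_list (p g) e))"
      using that by (intro sum.cong) (auto simp: y_def flow_index_def arcs_of_def)
    \<comment> \<open>An arc of \<open>A\<close> outside \<open>arcs_of g\<close> lies on no route
      of \<open>g\<close>, so its count in \<open>p g\<close> is 0.\<close>
    also have "\<dots> = (\<Sum>e \<in> A. demand g * real (count_list (p g) e))"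
      using that p[of g] \<open>finite A\<close>
      by (intro sum.mono_neutral_left) (auto simp: arcs_of_def groups_on_def count_list_0_iff)
    finally show ?thesis
      by (simp add: sum_distrib_left)
  qed
  moreover have "demand g * of_bool (i = orig g) + demand g * real (\<Sum>e \<in> in_arcs N i. count_list (p g) e)
      = demand g * of_bool (i = dest g) + demand g * real (\<Sum>e \<in> out_arcs N i. count_list (p g) e)"
    if "g \<in> groups" for g i
  proof -
    have "real (of_bool (i = orig g) + (\<Sum>e \<in> in_arcs N i. count_list (p g) e))
      = real (of_bool (i = dest g) + (\<Sum>e \<in> out_arcs N i. count_list (p g) e))"
      using awalk_flow_balance[OF p[OF that], of i] by (rule arg_cong)
    then show ?thesis
      by (metis distrib_left of_nat_add of_nat_of_bool)
  qed
  ultimately have "y \<in> admissible_flows"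
    by (auto simp: admissible_flows_def eq in_arcs_def out_arcs_def simp del: of_nat_sum sum.insert)
  then show ?thesis by blast
qed

lemma admissible_convex:
  assumes y: "y \<in> admissible_flows" and z: "z \<in> admissible_flows" and s: "0 \<le> s" "s \<le> 1"
  shows "(\<lambda>i. (1 - s) * y i + s * z i) \<in> admissible_flows"
proof -
  let ?u = "\<lambda>i. (1 - s) * y i + s * z i"
  have "?u \<in> flows"
  proof -
    have "y \<in> flows" "z \<in> flows"
      using y z by (auto simp: admissible_flows_def)
    \<comment> \<open>Outside \<open>flow_index\<close> both flows equal \<open>undefined\<close>;
      the combination keeps this value, so it stays extensional.\<close>
    moreover have "(1 - s) * a + s * a = a" for a
      by (simp add: algebra_simps)
    ultimately show ?thesis
      using s by (auto simp: flows_def PiE_iff extensional_def)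
  qed
  moreover have sum: "(\<Sum>e \<in> A. \<Sum>k \<in> {1, 2}. ?u (e, k, t, g)) =
      (1 - s) * (\<Sum>e \<in> A. \<Sum>k \<in> {1, 2}. y (e, k, t, g)) + s * (\<Sum>e \<in> A. \<Sum>k \<in> {1, 2}. z (e, k, t, g))"
    for A t g
    by (simp only: sum.distrib sum_distrib_left)
  moreover have "d + ((1 - s) * p + s * q) = d' + ((1 - s) * p' + s * q')"
    if "d + p = d' + p'" "d + q = d' + q'" for d d' p q p' q' :: real
  proof -
    have "(1 - s) * (d + p) + s * (d + q) = (1 - s) * (d' + p') + s * (d' + q')"
      using that by simp
    then show ?thesis by (simp add: algebra_simps)
  qed
  ultimately show ?thesis
    using y z unfolding admissible_flows_def mem_Collect_eq sum by blast
qed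

text \<open>Each conservation equation involves a single group and a single period, so the block of
  one such pair can be exchanged independently of the others.\<close>

lemma admissible_patch:
  assumes "y \<in> admissible_flows" "z \<in> admissible_flows"
  shows "(\<lambda>(e, k, t', g'). if t' = t \<and> g' = g then z (e, k, t', g') else y (e, k, t', g'))
    \<in> admissible_flows"
proof -
  let ?u = "\<lambda>(e, k, t', g'). if t' = t \<and> g' = g then z (e, k, t', g') else y (e, k, t', g')"
  have "?u \<in> flows"
    using assms unfolding flows_def PiE_iff extensional_def admissible_flows_def by auto
  moreover have eq: "(\<Sum>e \<in> A. \<Sum>k \<in> {1, 2}. ?u (e, k, t', g'))
    = (if t' = t \<and> g' = g then \<Sum>e \<in> A. \<Sum>k \<in> {1, 2}. z (e, k, t', g')
       else \<Sum>e \<in> A. \<Sum>k \<in> {1, 2}. y (e, k, t', g'))" for A t' g'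
    by (auto simp del: sum.insert)
  ultimately show ?thesis
    using assms unfolding admissible_flows_def mem_Collect_eq eq
    by (simp only: split: if_split) blast
qed

section \<open>The Beckmann potential and its minimiser\<close>

text \<open>The weight \<open>w\<close> is a fixed price per unit of flow, in units of time.
  Formally, the partial derivative in the coordinate \<open>(e, k, t, g)\<close> is the lane latency
  plus \<open>w (e, k, t, g)\<close>.\<close>

definition potential :: "('e \<times> nat \<times> nat \<times> 'g \<Rightarrow> real) \<Rightarrow> ('e \<times> nat \<times> nat \<times> 'g \<Rightarrow> real) \<Rightarrow> real" where
  "potential w y = (\<Sum>e \<in> arcs N. \<Sum>k \<in> {1, 2}. \<Sum>t \<in> {1..T}.
     integral {0..lane_flow y e k t} (latency e) + (\<Sum>g \<in> groups_on e. w (e, k, t, g) * y (e, k, t, g)))"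

lemma continuous_on_flow [continuous_intros]:
  "continuous_on A (\<lambda>y :: 'e \<times> nat \<times> nat \<times> 'g \<Rightarrow> real. y i)"
  by (simp add: continuous_on_product_coordinates continuous_on_subset[OF _ subset_UNIV])

lemma continuous_on_integral_latency:
  assumes "e \<in> arcs N"
  shows "continuous_on {0..} (\<lambda>x. integral {0..x} (latency e))"
proof -
  have "continuous (at x within {0..}) (\<lambda>x. integral {0..x} (latency e))" if "0 \<le> x" for x
  proof -
    \<comment> \<open>The right end \<open>x + 1\<close> makes this compact interval a neighbourhood
      of \<open>x\<close> relative to \<open>{0..}\<close>, so continuity transfers to the
      half-line.\<close>
    have "continuous_on {0..x + 1} (\<lambda>x. integral {0..x} (latency e))"
      by (intro indefinite_integral_continuous_1 integrable_continuous_interval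
          continuous_on_subset[OF latency_continuous[OF assms]]) auto
    then have "continuous (at x within {0..x + 1}) (\<lambda>x. integral {0..x} (latency e))"
      using that by (simp add: continuous_on_eq_continuous_within)
    moreover have "at x within {0..} = at x within {0..x + 1}"
      by (rule at_within_nhd[of _ "{..<x + 1}"]) auto
    ultimately show ?thesis by simp
  qed
  then show ?thesis by (simp add: continuous_on_eq_continuous_within)
qed

lemma continuous_on_potential: "continuous_on admissible_flows (potential w)"
proof -
  have "continuous_on admissible_flows (\<lambda>y. integral {0..lane_flow y e k t} (latency e))"
    if "e \<in> arcs N" "k \<in> {1, 2}" "t \<in> {1..T}" for e k t
    using that lane_flow_nonneg
    by (intro continuous_on_compose2[OF continuous_on_integral_latency[of e]])
      (auto simp: lane_flow_def intro!: continuous_intros)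
  then show ?thesis
    unfolding potential_def by (intro continuous_intros) auto
qed

text \<open>A compact box is intersected with the closed set cut out by the conservation
  equations.\<close>

lemma compact_bounded_admissible:
  "compact {y \<in> admissible_flows. \<forall>(e, k, t, g) \<in> flow_index. y (e, k, t, g) \<le> M e}"
proof -
  \<comment> \<open>The singleton factors encode extensionality, so the box is a product over all
    indices.\<close>
  let ?S = "\<lambda>i. if i \<in> flow_index then {0..M (fst i)} else {undefined}"
  let ?B = "\<lambda>i g t. {y :: 'e \<times> nat \<times> nat \<times> 'g \<Rightarrow> real. demand g * of_bool (i = orig g)
       + (\<Sum>e \<in> in_arcs N i \<inter> arcs_of g. \<Sum>k \<in> {1, 2}. y (e, k, t, g))
     = demand g * of_bool (i = dest g)
       + (\<Sum>e \<in> out_arcs N i \<inter> arcs_of g. \<Sum>k \<in> {1, 2}. y (e, k, t, g))}"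
  have "{y \<in> admissible_flows. \<forall>(e, k, t, g) \<in> flow_index. y (e, k, t, g) \<le> M e}
      = {y. \<forall>i. y i \<in> ?S i} \<inter> (\<Inter>i \<in> verts N. \<Inter>g \<in> groups. \<Inter>t \<in> {1..T}. ?B i g t)"
    by (rule set_eqI) (auto simp: admissible_flows_def flows_def PiE_iff extensional_def
        split: if_splits simp del: sum.insert; fastforce)
  moreover have "closed (\<Inter>i \<in> verts N. \<Inter>g \<in> groups. \<Inter>t \<in> {1..T}. ?B i g t)"
    by (intro closed_INT ballI closed_Collect_eq continuous_intros)
  moreover have "compact {y. \<forall>i. y i \<in> ?S i}"
    by (rule compact_box_fun) simp
  ultimately show ?thesis
    by (simp only: compact_Int_closed)
qed

lemma integral_latency_nonneg: "e \<in> arcs N \<Longrightarrow> 0 \<le> integral {0..x} (latency e)"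
  by (intro integral_nonneg integrable_continuous_interval
      continuous_on_subset[OF latency_continuous]) (auto simp: latency_nonneg)

lemma latency_one_pos: "e \<in> arcs N \<Longrightarrow> 0 < latency e 1"
  using strict_mono_onD[OF latency_strict_mono, of e 0 1] latency_nonneg[of e 0] by simp

text \<open>Coercivity: the primitive of the latency grows at least linearly, with slope \<open>latency e 1 > 0\<close>.\<close>

lemma flow_le_potential:
  assumes w: "\<And>i. i \<in> flow_index \<Longrightarrow> 0 \<le> w i"
    and y: "y \<in> admissible_flows" and i: "(e, k, t, g) \<in> flow_index"
  shows "y (e, k, t, g) \<le> 1 + potential w y / latency e 1"
proof -
  have e: "e \<in> arcs N" and k: "k \<in> {1, 2}" and t: "t \<in> {1..T}" and g: "g \<in> groups_on e"
    using i by (auto simp: flow_index_def)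
  let ?x = "lane_flow y e k t"
  let ?f = "\<lambda>e k t. integral {0..lane_flow y e k t} (latency e)
    + (\<Sum>g \<in> groups_on e. w (e, k, t, g) * y (e, k, t, g))"
  have *: "0 \<le> (\<Sum>g \<in> groups_on e. w (e, k, t, g) * y (e, k, t, g))"
    if "e \<in> arcs N" "k \<in> {1, 2}" "t \<in> {1..T}" for e k t
    using that by (intro sum_nonneg mult_nonneg_nonneg w flow_nonneg[OF y]) (auto simp: flow_index_def)
  have nonneg: "0 \<le> ?f e k t" if "e \<in> arcs N" "k \<in> {1, 2}" "t \<in> {1..T}" for e k t
    using * that integral_latency_nonneg by (intro add_nonneg_nonneg) auto
  \<comment> \<open>The tangent is taken at the point 1, where the slope is positive.\<close>
  have "latency e 1 * (?x - 1) \<le> integral {0..?x} (latency e) - integral {0..1} (latency e)"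
    using lane_flow_nonneg[OF y e k t]
    by (intro integral_mono_tangent latency_continuous latency_mono e) auto
  also have "\<dots> \<le> ?f e k t"
    using *[OF e k t] integral_latency_nonneg[OF e, of 1] by simp
  \<comment> \<open>All terms are nonnegative, so a single one is bounded by the whole potential;
    the sums are restored from the inside out.\<close>
  also have "\<dots> \<le> (\<Sum>t \<in> {1..T}. ?f e k t)"
    using t nonneg[OF e k] by (intro member_le_sum) auto
  also have "\<dots> \<le> (\<Sum>k \<in> {1, 2}. \<Sum>t \<in> {1..T}. ?f e k t)"
    using k nonneg[OF e] by (intro member_le_sum[of k "{1, 2}"] sum_nonneg) auto
  also have "\<dots> \<le> potential w y"
    unfolding potential_def
    using e nonneg by (intro member_le_sum[of e "arcs N"] sum_nonneg) auto
  finally have "?x \<le> 1 + potential w y / latency e 1"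
    using latency_one_pos[OF e] by (simp add: field_simps)
  moreover have "y (e, k, t, g) \<le> ?x"
    unfolding lane_flow_def using g e k t
    by (intro member_le_sum[of g "groups_on e"] flow_nonneg[OF y]) (auto simp: flow_index_def)
  ultimately show ?thesis by linarith
qed

text \<open>By coercivity the sublevel set of the potential at some admissible \<open>y0\<close>
  lies in the compact set \<open>K\<close>. A minimiser on \<open>K\<close> is global: a flow
  outside \<open>K\<close> has a larger potential than \<open>y0\<close>, which itself lies in
  \<open>K\<close>.\<close>

lemma potential_minimum:
  assumes w: "\<And>i. i \<in> flow_index \<Longrightarrow> 0 \<le> w i"
  obtains y where "y \<in> admissible_flows"
    "\<And>z. z \<in> admissible_flows \<Longrightarrow> potential w y \<le> potential w z"
proof -
  obtain y0 where y0: "y0 \<in> admissible_flows"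
    using admissible_nonempty by blast
  define M where "M e = 1 + potential w y0 / latency e 1" for e
  define K where "K = {y \<in> admissible_flows. \<forall>(e, k, t, g) \<in> flow_index. y (e, k, t, g) \<le> M e}"
  have K: "z \<in> K" if "z \<in> admissible_flows" "potential w z \<le> potential w y0" for z
  proof -
    have "z (e, k, t, g) \<le> M e" if i: "(e, k, t, g) \<in> flow_index" for e k t g
    proof -
      have "z (e, k, t, g) \<le> 1 + potential w z / latency e 1"
        by (rule flow_le_potential[OF w \<open>z \<in> admissible_flows\<close> i])
      also have "\<dots> \<le> M e"
        using i that(1) \<open>potential w z \<le> potential w y0\<close> latency_one_pos[of e]
        by (auto simp: M_def flow_index_def intro!: divide_right_mono)
      finally show ?thesis .
    qed
    then show ?thesis using that by (auto simp: K_def)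
  qed
  have "compact K" unfolding K_def by (rule compact_bounded_admissible)
  moreover have "continuous_on K (potential w)"
    by (rule continuous_on_subset[OF continuous_on_potential]) (auto simp: K_def)
  ultimately obtain y where y: "y \<in> K" "\<And>z. z \<in> K \<Longrightarrow> potential w y \<le> potential w z"
    using continuous_attains_inf[of K "potential w"] K[OF y0] by blast
  show ?thesis
  proof
    show "y \<in> admissible_flows" using y by (simp add: K_def)
    show "potential w y \<le> potential w z" if "z \<in> admissible_flows" for z
      using K[OF y0] K[OF that] y(2)[of y0] y(2)[of z] by fastforce
  qed
qed

section \<open>First-order conditions at a minimiser\<close>

lemma lane_flow_combine:
  "lane_flow (\<lambda>i. (1 - s) * y i + s * z i) e k t = (1 - s) * lane_flow y e k t + s * lane_flow z e k t"
  by (simp add: lane_flow_def sum.distrib sum_distrib_left)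

text \<open>First-order optimality without differentiating the potential: along the segment from
  \<open>y\<close> to \<open>z\<close>, convexity of the primitives gives
  \<open>s * D s >= 0\<close> for \<open>0 < s < 1\<close>. Dividing by \<open>s\<close> and letting
  \<open>s\<close> tend to 0 gives the claim.\<close>

lemma potential_minimum_variational:
  assumes y: "y \<in> admissible_flows"
    and min: "\<And>z. z \<in> admissible_flows \<Longrightarrow> potential w y \<le> potential w z"
    and z: "z \<in> admissible_flows"
  shows "0 \<le> (\<Sum>e \<in> arcs N. \<Sum>k \<in> {1, 2}. \<Sum>t \<in> {1..T}. \<Sum>g \<in> groups_on e.
    (z (e, k, t, g) - y (e, k, t, g)) * (latency e (lane_flow y e k t) + w (e, k, t, g)))"
proof -
  define u where "u s i = (1 - s) * y i + s * z i" for s i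
  define D where "D s = (\<Sum>e \<in> arcs N. \<Sum>k \<in> {1, 2}. \<Sum>t \<in> {1..T}. \<Sum>g \<in> groups_on e.
    (z (e, k, t, g) - y (e, k, t, g)) * (latency e (lane_flow (u s) e k t) + w (e, k, t, g)))" for s
  have adm: "u s \<in> admissible_flows" if "0 \<le> s" "s \<le> 1" for s
    using admissible_convex[OF y z that] unfolding u_def .
  have lane: "lane_flow (u s) e k t = (1 - s) * lane_flow y e k t + s * lane_flow z e k t" for s e k t
    unfolding u_def by (rule lane_flow_combine)
  have "continuous_on {0..1} (\<lambda>s. latency e (lane_flow (u s) e k t))"
    if "e \<in> arcs N" "k \<in> {1, 2}" "t \<in> {1..T}" for e k t
  proof (rule continuous_on_compose2[OF latency_continuous[OF that(1)]])
    show "continuous_on {0..1} (\<lambda>s. lane_flow (u s) e k t)"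
      unfolding lane by (intro continuous_intros)
    show "(\<lambda>s. lane_flow (u s) e k t) ` {0..1} \<subseteq> {0..}"
      using that adm lane_flow_nonneg by auto
  qed
  then have cont: "continuous_on {0..1} D"
    unfolding D_def by (intro continuous_intros) auto
  have pos: "0 \<le> D s" if s: "s \<in> {0<..<1}" for s
  proof -
    have "0 \<le> potential w (u s) - potential w y"
      using min[OF adm[of s]] s by simp
    also have "\<dots> = (\<Sum>e \<in> arcs N. \<Sum>k \<in> {1, 2}. \<Sum>t \<in> {1..T}.
        (integral {0..lane_flow (u s) e k t} (latency e) - integral {0..lane_flow y e k t} (latency e))
        + (\<Sum>g \<in> groups_on e. w (e, k, t, g) * (u s (e, k, t, g) - y (e, k, t, g))))"
      unfolding potential_def sum_subtractf[symmetric]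
      by (intro sum.cong refl) (simp add: sum_subtractf right_diff_distrib)
    \<comment> \<open>An upper bound on the increment is required, hence the tangent at the moved
      flow \<open>u s\<close>; the tangent at \<open>y\<close> would bound it from below.\<close>
    also have "\<dots> \<le> (\<Sum>e \<in> arcs N. \<Sum>k \<in> {1, 2}. \<Sum>t \<in> {1..T}.
        latency e (lane_flow (u s) e k t) * (lane_flow (u s) e k t - lane_flow y e k t)
        + (\<Sum>g \<in> groups_on e. w (e, k, t, g) * (u s (e, k, t, g) - y (e, k, t, g))))"
    proof (intro sum_mono add_right_mono)
      fix e t and k :: nat assume ekt: "e \<in> arcs N" "k \<in> {1, 2}" "t \<in> {1..T}"
      have "latency e (lane_flow (u s) e k t) * (lane_flow y e k t - lane_flow (u s) e k t)
        \<le> integral {0..lane_flow y e k t} (latency e) - integral {0..lane_flow (u s) e k t} (latency e)"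
        using ekt s adm y
        by (intro integral_mono_tangent latency_continuous latency_mono lane_flow_nonneg) auto
      then show "integral {0..lane_flow (u s) e k t} (latency e) - integral {0..lane_flow y e k t} (latency e)
        \<le> latency e (lane_flow (u s) e k t) * (lane_flow (u s) e k t - lane_flow y e k t)"
        by (simp add: algebra_simps)
    qed
    \<comment> \<open>Every coordinate moves by \<open>s\<close> times that of \<open>z - y\<close>,
      and lane flows add these moves over the groups, so latency and price terms merge.\<close>
    also have "\<dots> = s * D s"
      unfolding D_def sum_distrib_left
    proof (intro sum.cong refl)
      fix e t and k :: nat
      have "lane_flow (u s) e k t - lane_flow y e k t
        = (\<Sum>g \<in> groups_on e. s * (z (e, k, t, g) - y (e, k, t, g)))"
        unfolding lane_flow_def sum_subtractf[symmetric]
        by (intro sum.cong) (auto simp: u_def algebra_simps)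
      moreover have "u s i - y i = s * (z i - y i)" for i
        by (simp add: u_def algebra_simps)
      ultimately show "latency e (lane_flow (u s) e k t) * (lane_flow (u s) e k t - lane_flow y e k t)
        + (\<Sum>g \<in> groups_on e. w (e, k, t, g) * (u s (e, k, t, g) - y (e, k, t, g)))
        = (\<Sum>g \<in> groups_on e. s * ((z (e, k, t, g) - y (e, k, t, g))
            * (latency e (lane_flow (u s) e k t) + w (e, k, t, g))))"
        by (simp only: sum_distrib_left sum.distrib[symmetric]) (simp add: algebra_simps)
    qed
    finally show ?thesis
      using s by (simp add: zero_le_mult_iff)
  qed
  \<comment> \<open>The sign passes to the limit because 0 lies in the closure of the open interval
    and \<open>D\<close> is continuous up to it.\<close>
  have "0 \<le> D 0"
    by (rule continuous_ge_on_closure[of "{0<..<1}" D]) (use cont pos in auto)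
  moreover have "u 0 = y"
    by (simp add: u_def fun_eq_iff)
  ultimately show ?thesis
    by (simp only: D_def)
qed

text \<open>The test flow follows \<open>z\<close> on the block of \<open>g\<close> and
  \<open>t\<close> and equals \<open>y\<close> elsewhere, so all other summands vanish. This
  separation permits a later rescaling by a factor that depends on group and period.\<close>

lemma potential_minimum_variational_group:
  assumes y: "y \<in> admissible_flows"
    and min: "\<And>z. z \<in> admissible_flows \<Longrightarrow> potential w y \<le> potential w z"
    and z: "z \<in> admissible_flows" and g: "g \<in> groups" and t: "t \<in> {1..T}"
  shows "0 \<le> (\<Sum>e \<in> arcs_of g. \<Sum>k \<in> {1, 2}.
    (z (e, k, t, g) - y (e, k, t, g)) * (latency e (lane_flow y e k t) + w (e, k, t, g)))"
proof -
  let ?z = "\<lambda>(e, k, t', g'). if t' = t \<and> g' = g then z (e, k, t', g') else y (e, k, t', g')"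
  let ?a = "\<lambda>e k t g. (z (e, k, t, g) - y (e, k, t, g))
    * (latency e (lane_flow y e k t) + w (e, k, t, g))"
  have "0 \<le> (\<Sum>e \<in> arcs N. \<Sum>k \<in> {1, 2}. \<Sum>t' \<in> {1..T}. \<Sum>g' \<in> groups_on e.
    (?z (e, k, t', g') - y (e, k, t', g')) * (latency e (lane_flow y e k t') + w (e, k, t', g')))"
    by (rule potential_minimum_variational[OF y min admissible_patch[OF y z]])
  also have "\<dots> = (\<Sum>e \<in> arcs N. \<Sum>k \<in> {1, 2}. \<Sum>t' \<in> {1..T}. if t' = t then
      (\<Sum>g' \<in> groups_on e. if g' = g then ?a e k t g else 0) else 0)"
    by (intro sum.cong refl) (auto simp del: sum.insert sum.delta sum.delta' intro!: sum.cong sum.neutral)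
  also have "\<dots> = (\<Sum>e \<in> arcs N. if g \<in> groups_on e then \<Sum>k \<in> {1, 2}. ?a e k t g else 0)"
    using t by (intro sum.cong refl) (auto simp: sum.delta)
  also have "\<dots> = (\<Sum>e \<in> arcs_of g. \<Sum>k \<in> {1, 2}. ?a e k t g)"
    unfolding arcs_of_def by (rule sum.inter_filter[symmetric]) simp
  finally show ?thesis .
qed

section \<open>From minimisers to equilibria\<close>

lemma dbcp_equilibrium_exists:
  assumes \<tau>: "\<tau> \<in> arcs N \<times> {1..T} \<rightarrow> {0..}"
    and \<alpha>: "\<alpha> \<in> arcs N \<times> {1..T} \<rightarrow> {0..1}"
  shows "dbcp_equilibria \<tau> \<alpha> \<noteq> {}"
proof -
  \<comment> \<open>The toll after discount, divided by the value of time. In these units the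
    latency part is common to all groups, and their differences enter only through terms linear in
    the flow.\<close>
  define w where "w = (\<lambda>(e, k, t, g). (if k = (1::nat) then
    (if g \<in> GE then (1 - \<alpha> (e, t)) * \<tau> (e, t) else \<tau> (e, t)) / vot g t else 0))"
  have "0 \<le> w i" if "i \<in> flow_index" for i
  proof -
    obtain e k t g where i: "i = (e, k, t, g)" by (cases i)
    with that have "0 \<le> \<tau> (e, t)" "\<alpha> (e, t) \<le> 1" "0 < vot g t"
      using \<tau> \<alpha> vot_pos by (auto simp: flow_index_def groups_on_def groups_def Pi_iff)
    then show ?thesis by (simp add: i w_def)
  qed
  then obtain y where y: "y \<in> admissible_flows"
    and min: "\<And>z. z \<in> admissible_flows \<Longrightarrow> potential w y \<le> potential w z"
    using potential_minimum by blast
  have "0 \<le> (\<Sum>e \<in> arcs_of g. \<Sum>k \<in> {1, 2}. \<Sum>t \<in> {1..T}.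
      (z (e, k, t, g) - y (e, k, t, g)) * cost \<tau> \<alpha> y e k t g)"
    if g: "g \<in> groups" and z: "z \<in> admissible_flows" for g z
  proof -
    have cost: "cost \<tau> \<alpha> y e k t g = vot g t * (latency e (lane_flow y e k t) + w (e, k, t, g))"
      if "k \<in> {1, 2}" "t \<in> {1..T}" for e k t
      using vot_pos[of g t] g that by (auto simp: cost_def w_def groups_def field_simps)
    \<comment> \<open>The inequality holds in each period separately, so it survives weighting by
      the positive values of time, which turns marginal potentials back into costs.\<close>
    have "0 \<le> (\<Sum>t \<in> {1..T}. vot g t * (\<Sum>e \<in> arcs_of g. \<Sum>k \<in> {1, 2}.
        (z (e, k, t, g) - y (e, k, t, g)) * (latency e (lane_flow y e k t) + w (e, k, t, g))))"
      using vot_pos[of g] g potential_minimum_variational_group[OF y min z g]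
      by (intro sum_nonneg[of "{1..T}"] mult_nonneg_nonneg) (auto simp: groups_def less_imp_le)
    also have "\<dots> = (\<Sum>t \<in> {1..T}. \<Sum>e \<in> arcs_of g. \<Sum>k \<in> {1, 2}.
        (z (e, k, t, g) - y (e, k, t, g)) * cost \<tau> \<alpha> y e k t g)"
      unfolding sum_distrib_left by (intro sum.cong refl) (simp add: cost)
    also have "\<dots> = (\<Sum>e \<in> arcs_of g. \<Sum>t \<in> {1..T}. \<Sum>k \<in> {1, 2}.
        (z (e, k, t, g) - y (e, k, t, g)) * cost \<tau> \<alpha> y e k t g)"
      by (rule sum.swap)
    also have "\<dots> = (\<Sum>e \<in> arcs_of g. \<Sum>k \<in> {1, 2}. \<Sum>t \<in> {1..T}.
        (z (e, k, t, g) - y (e, k, t, g)) * cost \<tau> \<alpha> y e k t g)"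
      by (intro sum.cong refl sum.swap)
    finally show ?thesis .
  qed
  with y show ?thesis
    unfolding dbcp_equilibria_def by blast
qed

end

theorem proposition4p1:
  fixes N :: "('i, 'e) pre_digraph" and T :: nat
    and latency :: "'e \<Rightarrow> real \<Rightarrow> real"
    and GE GI :: "'g set"
    and orig dest :: "'g \<Rightarrow> 'i"
    and demand :: "'g \<Rightarrow> real"
    and vot :: "'g \<Rightarrow> nat \<Rightarrow> real"
    and \<tau> \<alpha> :: "'e \<times> nat \<Rightarrow> real"
  assumes "dbcp_network N T latency GE GI orig dest demand vot"
    and "\<tau> \<in> arcs N \<times> {1..T} \<rightarrow> {0..}"
    and "\<alpha> \<in> arcs N \<times> {1..T} \<rightarrow> {0..1}"
  shows "dbcp_network.dbcp_equilibria N T latency GE GI orig dest demand vot \<tau> \<alpha> \<noteq> {}"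
  by (rule dbcp_network.dbcp_equilibrium_exists[OF assms])

end
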